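(* Suppose that for all coprime integers $p>q\ge 1$ the following holds: for every $u\in\mathcal{L}_{p/q}$, the infinite word $\mathtt{wmax}_{p/q}(u)$ is normal over the alphabet $\{p-q,\dots,p-1\}$, and for every $u\in\mathcal{L}_{p/q}$ with $u\neq\epsilon$, the infinite word $\mathtt{wmin}_{p/q}(u)$ is normal over the alphabet $\{0,\dots,q-1\}$. Then for all coprime integers $p>q\ge 1$, every positive real number $x$ admits at most two expansions in rational base $p/q$.
   Context: Here $\mathbb{N}=\{0,1,2,\dots\}$. Rational base expansions of integers. Let $p>q\ge 1$ be coprime integers. The expansion $\mathtt{rep}_{p/q}(n)$ of $n\in\mathbb{N}$ in base $p/q$ is the unique finite word $a_ka_{k-1}\cdots a_0$ over $\{0,\dots,p-1\}$ not starting with the letter $0$ and such that $n=\frac1q\sum_{i=0}^k a_i\left(\frac pq\right)^i$ (the expansion of $0$ is the empty word $\epsilon$). Put $\mathcal{L}_{p/q}=\{\mathtt{rep}_{p/q}(n): n\in\mathbb{N}\}$. This language is prefix-closed, and every word of it can be extended on the right by some letter of $\{0,\dots,p-1\}$ to a word of $\mathcal{L}_{p/q}$. Minimal and maximal words. For $u\in\mathcal{L}_{p/q}$, the minimal (resp. maximal) word with seed $u$, denoted $\mathtt{wmin}_{p/q}(u)$ (resp. $\mathtt{wmax}_{p/q}(u)$), is the unique infinite word such that, for every $l\in\mathbb{N}$, its prefix of length $l$ is the lexicographically smallest (resp. largest) word $v\in\{0,\dots,p-1\}^l$ such that the concatenation $uv$ belongs to $\mathcal{L}_{p/q}$. (Equivalently,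 it is built letter by letter, starting from $u$, by always appending the smallest (resp. largest) letter keeping the word in $\mathcal{L}_{p/q}$.) Normality. An infinite word $w=w_0w_1w_2\cdots$ over an alphabet $A$ with $d$ letters is normal over $A$ if for every $l\ge 1$ and every $v\in A^l$, $\lim_{N\to\infty}\frac1N\,\mathrm{Card}\{0\le m<N : w_m\cdots w_{m+l-1}=v\}=\frac{1}{d^l}$. Expansions of real numbers. An infinite word $w=a_ka_{k-1}\cdots a_0a_{-1}a_{-2}\cdots$ over $\{0,\dots,p-1\}$ (with its digits indexed by positions $l\le k$) is an expansion of a positive real number $x$ in rational base $p/q$ if every finite prefix of $w$ belongs to $\{0^ju : j\in\mathbb{N},\ u\in\mathcal{L}_{p/q}\}$ and $x=\frac1q\sum_{l\le k}a_l\left(\frac pq\right)^l$. Two expansions that differ only by zeros added or removed at the beginning (i.e. that define the same digit sequence $(a_l)_{l\in\mathbb{Z}}$ once $a_l$ is set to $0$ for $l>k$) are regarded as the same expansion. *)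

theory Defs
  imports Complex_Main
begin

text \<open>
  Finite words are lists of natural numbers, leftmost (most significant) letter first;
  infinite words are functions on \<^typ>\<open>nat\<close>.
\<close>

definition words :: "nat set \<Rightarrow> nat \<Rightarrow> nat list set" where
  "words A l = {v. set v \<subseteq> A \<and> length v = l}"

definition inf_prefix :: "nat \<Rightarrow> (nat \<Rightarrow> nat) \<Rightarrow> nat list" where
  "inf_prefix l w = map w [0..<l]"

text \<open>
  For the word \<open>a\<^sub>k \<dots> a\<^sub>0\<close>, the letter \<open>a\<^sub>i\<close> is the entry with index \<open>i\<close> of the reversed list.
\<close>

definition word_value :: "nat \<Rightarrow> nat \<Rightarrow> nat list \<Rightarrow> real" where
  "word_value p q u =
     1 / real q * (\<Sum>i<length u. real (rev u ! i) * (real p / real q) ^ i)"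

definition rep :: "nat \<Rightarrow> nat \<Rightarrow> nat \<Rightarrow> nat list" where
  "rep p q n =
     (THE u. set u \<subseteq> {..<p} \<and> (u \<noteq> [] \<longrightarrow> hd u \<noteq> 0) \<and> real n = word_value p q u)"

definition rep_lang :: "nat \<Rightarrow> nat \<Rightarrow> nat list set" where
  "rep_lang p q = range (rep p q)"

definition extensions :: "nat \<Rightarrow> nat \<Rightarrow> nat list \<Rightarrow> nat \<Rightarrow> nat list set" where
  "extensions p q u l = {v \<in> words {..<p} l. u @ v \<in> rep_lang p q}"

definition lex_smallest :: "nat list set \<Rightarrow> nat list \<Rightarrow> bool" where
  "lex_smallest S v \<longleftrightarrow> v \<in> S \<and> (\<forall>v'\<in>S. v = v' \<or> (v, v') \<in> lexord less_than)"

definition lex_largest :: "nat list set \<Rightarrow> nat list \<Rightarrow> bool" where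
  "lex_largest S v \<longleftrightarrow> v \<in> S \<and> (\<forall>v'\<in>S. v = v' \<or> (v', v) \<in> lexord less_than)"

definition wmin :: "nat \<Rightarrow> nat \<Rightarrow> nat list \<Rightarrow> nat \<Rightarrow> nat" where
  "wmin p q u = (THE w. \<forall>l. lex_smallest (extensions p q u l) (inf_prefix l w))"

definition wmax :: "nat \<Rightarrow> nat \<Rightarrow> nat list \<Rightarrow> nat \<Rightarrow> nat" where
  "wmax p q u = (THE w. \<forall>l. lex_largest (extensions p q u l) (inf_prefix l w))"

definition normal_over :: "nat set \<Rightarrow> (nat \<Rightarrow> nat) \<Rightarrow> bool" where
  "normal_over A w \<longleftrightarrow>
     range w \<subseteq> A \<and>
     (\<forall>l\<ge>1. \<forall>v\<in>words A l.
        (\<lambda>N. real (card {m. m < N \<and> map w [m..<m + l] = v}) / real N)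
          \<longlonglongrightarrow> 1 / real (card A) ^ l)"

text \<open>
  An infinite word \<open>a\<^sub>k a\<^sub>k\<^sub>-\<^sub>1 \<dots> a\<^sub>0 a\<^sub>-\<^sub>1 \<dots>\<close> with indexed positions is given by the position \<open>k\<close>
  of its first digit together with the function \<open>w\<close> such that \<open>w i\<close> is the digit
  at position \<open>k - i\<close>.
\<close>

definition is_expansion :: "nat \<Rightarrow> nat \<Rightarrow> real \<Rightarrow> int \<Rightarrow> (nat \<Rightarrow> nat) \<Rightarrow> bool" where
  "is_expansion p q x k w \<longleftrightarrow>
     range w \<subseteq> {..<p} \<and>
     (\<forall>n. inf_prefix n w \<in> {replicate j 0 @ u | j u. u \<in> rep_lang p q}) \<and>
     (\<lambda>i. 1 / real q * (real (w i) * (real p / real q) powi (k - int i))) sums x"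

text \<open>
  The bi-infinite digit sequence, padded with zeros on the left. Two expansions are
  regarded as the same iff they have the same digit sequence.
\<close>

definition digit_sequence :: "int \<Rightarrow> (nat \<Rightarrow> nat) \<Rightarrow> int \<Rightarrow> nat" where
  "digit_sequence k w = (\<lambda>l. if l \<le> k then w (nat (k - l)) else 0)"

definition expansions :: "nat \<Rightarrow> nat \<Rightarrow> real \<Rightarrow> (int \<Rightarrow> nat) set" where
  "expansions p q x = {digit_sequence k w | k w. is_expansion p q x k w}"

end

theory Submission imports Defs begin

text \<open>
  Arrange the natural numbers in a tree in which the parent of \<open>n\<close> is \<open>q * n div p\<close>. The digit
  string of \<open>n\<close> in base \<open>p/q\<close> is read off the way from the root to \<open>n\<close>, the last digit being
  \<open>q * n mod p\<close>. An expansion of a real number is thus an infinite branch of this tree, and its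
  truncations \<open>N l\<close> at position \<open>l\<close> satisfy \<open>N l * (p/q)^l \<le> x \<le> (N l + p) * (p/q)^l\<close> by
  comparison with a geometric series (\<open>expansion_truncations\<close>). Any two branches that belong to
  the same \<open>x\<close> therefore stay at distance at most \<open>p\<close> for ever.

  Suppose that \<open>x\<close> had three expansions. From some position on the three branches occupy
  different nodes, say \<open>a < b < c\<close>. Taking parents is monotone, so the descendants of \<open>b\<close> at any
  depth lie between the branch through \<open>a\<close> and the one through \<open>c\<close>; their number is at
  most \<open>p\<close> at every depth (\<open>no_node_between_branches\<close>).

  On the other hand, if a node \<open>n \<ge> 1\<close> had only one descendant at each depth, its
  minimal and maximal words would coincide; but the maximal word avoids the letter \<open>0\<close>, since its
  letters are at least \<open>p - q\<close>, while by normality the minimal word contains it with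
  frequency \<open>1/q\<close>. Hence every node \<open>n \<ge> 1\<close> eventually branches
  (\<open>normality_imp_branching\<close>). Each further branching enlarges the set of descendants
  of \<open>b\<close>, so these sets grow beyond every bound (\<open>many_descendants\<close>), a contradiction.
\<close>

section \<open>The tree of integers\<close>

definition parent :: "nat \<Rightarrow> nat \<Rightarrow> nat \<Rightarrow> nat" where
  "parent p q n = q * n div p"

definition descendants :: "nat \<Rightarrow> nat \<Rightarrow> nat \<Rightarrow> nat \<Rightarrow> nat set" where
  "descendants p q n s = {m. (parent p q ^^ s) m = n}"

lemma mono_parent: "mono (parent p q)"
  by (intro monoI) (simp add: parent_def div_le_mono)

lemma mono_parent_funpow: "mono (parent p q ^^ s)"
  by (intro monoI funpow_mono mono_parent)

locale rational_base =
  fixes p q :: nat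
  assumes coprime_pq: "coprime p q" and q_less_p: "q < p" and q_pos: "1 \<le> q"
begin

lemma parent_less: "0 < n \<Longrightarrow> parent p q n < n"
  using q_less_p by (simp add: parent_def less_mult_imp_div_less mult.commute)

lemma surj_parent: "surj (parent p q)"
proof (rule surjI)
  fix n
  let ?m = "(p * n + (q - 1)) div q"
  \<comment> \<open>the least integer that is at least \<open>p * n / q\<close>\<close>
  have "q * ?m + (p * n + (q - 1)) mod q = p * n + (q - 1)"
    by simp
  moreover have "(p * n + (q - 1)) mod q < q"
    using q_pos by simp
  ultimately have "p * n \<le> q * ?m" "q * ?m < p * n + p"
    using q_less_p q_pos by linarith+
  then show "parent p q ?m = n"
    unfolding parent_def by (intro div_nat_eqI) (simp_all add: algebra_simps)
qed

lemma finite_descendants: "finite (descendants p q n s)"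
proof (induction s)
  case 0
  then show ?case by (simp add: descendants_def)
next
  case (Suc s)
  have fibre: "finite {m. parent p q m = j}" for j
  proof (rule finite_subset)
    show "{m. parent p q m = j} \<subseteq> {..p * Suc j}"
    proof
      fix m assume "m \<in> {m. parent p q m = j}"
      then have "j = q * m div p" by (simp add: parent_def)
      then have "q * m < p * Suc j"
        using q_less_p by (simp add: dividend_less_times_div)
      moreover have "m \<le> q * m" using mult_le_mono1[OF q_pos, of m] by simp
      ultimately have "m \<le> p * Suc j" by linarith
      then show "m \<in> {..p * Suc j}" by simp
    qed
  qed simp
  have "descendants p q n (Suc s) = (\<Union>j\<in>descendants p q n s. {m. parent p q m = j})"
    by (auto simp: descendants_def funpow_swap1)
  with Suc.IH fibre show ?case by simp
qed

text \<open>
  The descendants at a given depth surject onto those at a smaller depth. As soon as one of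
  the latter branches, this surjection is not injective, so the cardinality grows.
\<close>

lemma many_descendants:
  assumes branching:
      "\<And>n. 1 \<le> n \<Longrightarrow> \<exists>t. \<exists>x\<in>descendants p q n t. \<exists>y\<in>descendants p q n t. x \<noteq> y"
    and "1 \<le> n"
  shows "\<exists>s. k \<le> card (descendants p q n s)"
proof (induction k)
  case 0
  then show ?case by simp
next
  case (Suc k)
  then obtain s where s: "k \<le> card (descendants p q n s)" by blast
  obtain m where m: "(parent p q ^^ s) m = n"
    using surj_fn[OF surj_parent] by (metis surjD)
  \<comment> \<open>Branching is available for positive nodes only, so the root must not descend from \<open>n\<close>.\<close>
  have "(parent p q ^^ s) 0 = 0"
    by (induction s) (simp_all add: parent_def)
  with m \<open>1 \<le> n\<close> have "1 \<le> m" by (cases m) auto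
  with branching obtain t x y where xy:
    "(parent p q ^^ t) x = m" "(parent p q ^^ t) y = m" "x \<noteq> y"
    unfolding descendants_def by blast
  let ?f = "parent p q ^^ t"
  let ?D = "descendants p q n (s + t)"
  have surj: "?f ` ?D = descendants p q n s"
  proof -
    have "?D = ?f -` descendants p q n s"
      by (auto simp: descendants_def funpow_add)
    then show ?thesis
      using surj_fn[OF surj_parent] by (simp add: surj_image_vimage_eq)
  qed
  have "x \<in> ?D" "y \<in> ?D"
    using xy m by (simp_all add: descendants_def funpow_add)
  with xy have "\<not> inj_on ?f ?D"
    by (auto dest: inj_onD)
  with finite_descendants have "card (?f ` ?D) \<noteq> card ?D"
    using eq_card_imp_inj_on by blast
  moreover have "card (?f ` ?D) \<le> card ?D"
    using finite_descendants by (rule card_image_le)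
  ultimately have "Suc k \<le> card ?D"
    using surj s by simp
  then show ?case by blast
qed

section \<open>Representations of integers\<close>

lemma word_value_Nil: "word_value p q [] = 0"
  by (simp add: word_value_def)

lemma word_value_snoc:
  "word_value p q (u @ [a]) = (real p * word_value p q u + real a) / real q"
  by (simp add: word_value_def sum.lessThan_Suc_shift sum_distrib_left sum_distrib_right
      add_divide_distrib sum_divide_distrib mult_ac del: sum.lessThan_Suc)

lemma word_value_replicate_zero: "word_value p q (replicate j 0 @ u) = word_value p q u"
proof (induction u rule: rev_induct)
  case Nil
  have "word_value p q (replicate j 0) = 0"
  proof (induction j)
    case (Suc j)
    have "replicate (Suc j) (0::nat) = replicate j 0 @ [0]"
      by (simp add: replicate_append_same)
    with Suc show ?case by (simp only: word_value_snoc) simp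
  qed (simp add: word_value_Nil)
  then show ?case by (simp add: word_value_Nil)
next
  case (snoc a u)
  then show ?case
    by (simp add: word_value_snoc flip: append_assoc)
qed

lemma word_value_fraction: "\<exists>A. word_value p q u = real A / real q ^ length u"
proof (induction u rule: rev_induct)
  case Nil
  show ?case by (rule exI[of _ 0]) (simp add: word_value_Nil)
next
  case (snoc a u)
  then obtain A where "word_value p q u = real A / real q ^ length u" by blast
  then show ?case
    using q_pos
    by (intro exI[of _ "p * A + a * q ^ length u"]) (simp add: word_value_snoc field_simps)
qed

text \<open>
  A prefix of a word with integral value has integral value: a priori its value has a power
  of \<open>q\<close> as denominator, but after multiplication by \<open>p\<close>, which is coprime to \<open>q\<close>, it is integral.
\<close>

lemma word_value_snoc_eq_nat:
  assumes "a < p" and eq_m: "word_value p q (u @ [a]) = real m"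
  shows "word_value p q u = real (parent p q m)" and "a = q * m mod p"
proof -
  obtain A where A: "word_value p q u = real A / real q ^ length u"
    using word_value_fraction by blast
  let ?Q = "q ^ length u"
  have "real (q * m * ?Q) = real (p * A + a * ?Q)"
    using eq_m q_pos by (simp add: word_value_snoc A field_simps)
  then have eq: "q * m * ?Q = p * A + a * ?Q"
    by (simp only: of_nat_eq_iff)
  then have "?Q dvd p * A"
    by (metis dvd_add_left_iff dvd_triv_right)
  moreover have "coprime ?Q p"
    using coprime_pq by (simp add: coprime_commute)
  ultimately have "?Q dvd A"
    using coprime_dvd_mult_right_iff by blast
  then obtain B where B: "A = ?Q * B" by (rule dvdE)
  from eq B have "?Q * (q * m) = ?Q * (p * B + a)"
    by (simp add: algebra_simps)
  then have m: "q * m = p * B + a"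
    using q_pos by simp
  with \<open>a < p\<close> show "a = q * m mod p" by simp
  have "parent p q m = B"
    using m \<open>a < p\<close> by (simp add: parent_def)
  with A B q_pos show "word_value p q u = real (parent p q m)" by simp
qed

lemma word_value_prefix:
  assumes "set v \<subseteq> {..<p}" "word_value p q (u @ v) = real m"
  shows "word_value p q u = real ((parent p q ^^ length v) m)"
  using assms
proof (induction v arbitrary: m rule: rev_induct)
  case Nil
  then show ?case by simp
next
  case (snoc a v)
  then have "word_value p q (u @ v) = real (parent p q m)"
    using word_value_snoc_eq_nat(1)[of a "u @ v" m] by simp
  with snoc show ?case by (simp add: funpow_swap1)
qed

lemma word_value_eq_0:
  assumes "word_value p q u = 0" "u \<noteq> [] \<longrightarrow> hd u \<noteq> 0"
  shows "u = []"
  using assms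
proof (induction u rule: rev_induct)
  case Nil
  then show ?case by simp
next
  case (snoc a u)
  have "0 \<le> word_value p q u"
    by (simp add: word_value_def sum_nonneg)
  moreover have "real p * word_value p q u + real a = 0"
    using snoc.prems(1) q_pos by (simp add: word_value_snoc)
  ultimately have "a = 0" "word_value p q u = 0"
    using q_less_p by (simp_all add: add_nonneg_eq_0_iff)
  with snoc show ?case by (cases u) auto
qed

lemma word_value_inject:
  assumes "set u \<subseteq> {..<p}" "u \<noteq> [] \<longrightarrow> hd u \<noteq> 0" "word_value p q u = real m"
    and "set v \<subseteq> {..<p}" "v \<noteq> [] \<longrightarrow> hd v \<noteq> 0" "word_value p q v = real m"
  shows "u = v"
  using assms
proof (induction u arbitrary: v m rule: rev_induct)
  case Nil
  then have "word_value p q v = 0"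
    by (simp only: word_value_Nil)
  then show ?case
    using word_value_eq_0 Nil.prems(5) by blast
next
  case (snoc a u)
  show ?case
  proof (cases v rule: rev_cases)
    case Nil
    then have "word_value p q (u @ [a]) = 0"
      using snoc.prems(3,6) by (simp only: word_value_Nil)
    then show ?thesis
      using word_value_eq_0 snoc.prems(2) by blast
  next
    case v: (snoc v' b)
    have "a < p" "b < p" "set u \<subseteq> {..<p}" "set v' \<subseteq> {..<p}"
      using snoc.prems(1,4) v by auto
    moreover have "u \<noteq> [] \<longrightarrow> hd u \<noteq> 0" "v' \<noteq> [] \<longrightarrow> hd v' \<noteq> 0"
      using snoc.prems(2,5) v by auto
    moreover note word_value_snoc_eq_nat[OF \<open>a < p\<close> snoc.prems(3)]
      word_value_snoc_eq_nat[OF \<open>b < p\<close> snoc.prems(6)[unfolded v]]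
    ultimately show ?thesis
      using snoc.IH v by metis
  qed
qed

lemma word_value_exists:
  "\<exists>u. set u \<subseteq> {..<p} \<and> (u \<noteq> [] \<longrightarrow> hd u \<noteq> 0) \<and> real m = word_value p q u"
proof (induction m rule: less_induct)
  case (less m)
  show ?case
  proof (cases "m = 0")
    case True
    then show ?thesis by (intro exI[of _ "[]"]) (simp add: word_value_Nil)
  next
    case False
    with less parent_less obtain u where u: "set u \<subseteq> {..<p}" "u \<noteq> [] \<longrightarrow> hd u \<noteq> 0"
      "real (parent p q m) = word_value p q u" by blast
    let ?a = "q * m mod p"
    have decomp: "q * m = p * parent p q m + ?a"
      by (simp add: parent_def)
    have "?a \<noteq> 0" if "u = []"
    proof -
      have "parent p q m = 0" using u that by (simp add: word_value_Nil)
      with decomp False q_pos show ?thesis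
        by (metis add_0 mult_0_right mult_eq_0_iff not_one_le_zero)
    qed
    then have "hd (u @ [?a]) \<noteq> 0" using u by (cases u) auto
    moreover have "real m = word_value p q (u @ [?a])"
    proof -
      have "real q * real m = real p * real (parent p q m) + real ?a"
        using decomp by (metis of_nat_add of_nat_mult)
      with u q_pos show ?thesis by (simp add: word_value_snoc field_simps)
    qed
    moreover have "set (u @ [?a]) \<subseteq> {..<p}"
      using u q_less_p by simp
    ultimately show ?thesis by blast
  qed
qed

lemma rep_spec:
  "set (rep p q m) \<subseteq> {..<p} \<and> (rep p q m \<noteq> [] \<longrightarrow> hd (rep p q m) \<noteq> 0)
    \<and> real m = word_value p q (rep p q m)"
  unfolding rep_def
proof (rule theI')
  show "\<exists>!u. set u \<subseteq> {..<p} \<and> (u \<noteq> [] \<longrightarrow> hd u \<noteq> 0) \<and> real m = word_value p q u"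
    using word_value_exists[of m] word_value_inject[of _ m] by (intro ex_ex1I) metis+
qed

section \<open>Every node branches\<close>

lemma wmin_eq_wmax:
  assumes "\<And>l v v'. v \<in> extensions p q u l \<Longrightarrow> v' \<in> extensions p q u l \<Longrightarrow> v = v'"
  shows "wmin p q u = wmax p q u"
proof -
  have "lex_smallest (extensions p q u l) = lex_largest (extensions p q u l)" for l
    using assms[of _ l] unfolding lex_smallest_def lex_largest_def by (intro ext) blast
  then show ?thesis by (simp add: wmin_def wmax_def)
qed

lemma extensions_unique:
  assumes single: "\<And>t x y. x \<in> descendants p q n t \<Longrightarrow> y \<in> descendants p q n t \<Longrightarrow> x = y"
    and v: "v \<in> extensions p q (rep p q n) l" and v': "v' \<in> extensions p q (rep p q n) l"
  shows "v = v'"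
proof -
  have *: "\<exists>m\<in>descendants p q n l. rep p q n @ v = rep p q m"
    if v: "v \<in> extensions p q (rep p q n) l" for v
  proof -
    obtain m where m: "rep p q n @ v = rep p q m"
      using v by (auto simp: extensions_def rep_lang_def)
    have "word_value p q (rep p q n) = real ((parent p q ^^ length v) m)"
      using v rep_spec[of m] m by (intro word_value_prefix) (auto simp: extensions_def words_def)
    then have "(parent p q ^^ l) m = n"
      using rep_spec[of n] v by (simp add: extensions_def words_def)
    with m show ?thesis by (auto simp: descendants_def)
  qed
  from *[OF v] *[OF v'] single show ?thesis by (metis same_append_eq)
qed

lemma not_normal_over_both:
  assumes "normal_over {p - q..p - 1} w" "normal_over {0..q - 1} w"
  shows False
proof -
  have "w m \<noteq> 0" for m
  proof -
    have "w m \<in> {p - q..p - 1}"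
      using assms(1) unfolding normal_over_def by blast
    then show ?thesis using q_less_p by auto
  qed
  then have none: "{m. m < N \<and> map w [m..<m + 1] = [0]} = {}" for N
    by auto
  have "[0] \<in> words {0..q - 1} 1"
    by (simp add: words_def)
  then have "(\<lambda>N. real (card {m. m < N \<and> map w [m..<m + 1] = [0]}) / real N)
      \<longlonglongrightarrow> 1 / real (card {0..q - 1}) ^ 1"
    using assms(2) unfolding normal_over_def by blast
  then have "(\<lambda>N. 0) \<longlonglongrightarrow> 1 / real (card {0..q - 1}) ^ 1"
    unfolding none by simp
  then have "1 / real (card {0..q - 1}) ^ 1 = 0"
    by (rule LIMSEQ_unique) simp
  then show False by simp
qed

text \<open>
  A node with a single descendant at every depth would have the same minimal and maximal
  word, and this word would be normal over two alphabets, only one of which contains \<open>0\<close>.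
\<close>

lemma normality_imp_branching:
  assumes wmax: "\<forall>u \<in> rep_lang p q. normal_over {p - q..p - 1} (wmax p q u)"
    and wmin: "\<forall>u \<in> rep_lang p q. u \<noteq> [] \<longrightarrow> normal_over {0..q - 1} (wmin p q u)"
    and "1 \<le> n"
  shows "\<exists>t. \<exists>x\<in>descendants p q n t. \<exists>y\<in>descendants p q n t. x \<noteq> y"
proof (rule ccontr)
  assume "\<not> ?thesis"
  then have "x = y" if "x \<in> descendants p q n t" "y \<in> descendants p q n t" for t x y
    using that by blast
  then have "wmin p q (rep p q n) = wmax p q (rep p q n)"
    using extensions_unique by (intro wmin_eq_wmax) blast
  moreover have "rep p q n \<in> rep_lang p q"
    by (simp add: rep_lang_def)
  moreover have "rep p q n \<noteq> []"
    using rep_spec[of n] \<open>1 \<le> n\<close> by (auto simp: word_value_Nil)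
  ultimately show False
    using wmax wmin not_normal_over_both by metis
qed

section \<open>Expansions as branches\<close>

text \<open>
  For an expansion starting at position \<open>k\<close>, let \<open>b n\<close> be the integer written by its first \<open>n\<close>
  digits. These digits contribute \<open>b n * r powi (k + 1 - n)\<close> to \<open>x\<close>, where \<open>r = p/q\<close>. This
  increases to \<open>x\<close>, whereas \<open>(b n + p) * r powi (k + 1 - n)\<close> decreases to \<open>x\<close>: one more digit
  gains at most \<open>(p - 1)/q\<close> and the surplus loses \<open>p * (r - 1) = p * (p - q)/q\<close>,
  both times \<open>r powi (k - n)\<close>.
\<close>

lemma expansion_truncations:
  assumes "d \<in> expansions p q x"
  obtains N :: "int \<Rightarrow> nat" where
    "\<And>l. parent p q (N l) = N (l + 1)"
    "\<And>l. d l = q * N l mod p"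
    "\<And>l. real (N l) * (real p / real q) powi l \<le> x"
    "\<And>l. x \<le> real (N l + p) * (real p / real q) powi l"
proof -
  define r where "r = real p / real q"
  have r: "r > 1" using q_less_p q_pos by (simp add: r_def)
  obtain k w where d: "d = digit_sequence k w" and w: "is_expansion p q x k w"
    using assms unfolding expansions_def by blast
  have digits: "w i < p" for i
    using w by (auto simp: is_expansion_def)
  have sums: "(\<lambda>i. 1 / real q * (real (w i) * r powi (k - int i))) sums x"
    using w by (simp add: is_expansion_def r_def)
  have "\<exists>m. word_value p q (inf_prefix n w) = real m" for n
  proof -
    obtain j u where "inf_prefix n w = replicate j 0 @ u" "u \<in> rep_lang p q"
      using w unfolding is_expansion_def by blast
    then show ?thesis
      using rep_spec unfolding rep_lang_def by (metis rangeE word_value_replicate_zero)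
  qed
  then obtain b where b: "\<And>n. word_value p q (inf_prefix n w) = real (b n)" by metis
  have b0: "b 0 = 0"
    using b[of 0] by (simp add: inf_prefix_def word_value_Nil)
  have snoc: "inf_prefix (Suc n) w = inf_prefix n w @ [w n]" for n
    by (simp add: inf_prefix_def)
  have step: "parent p q (b (Suc n)) = b n" "w n = q * b (Suc n) mod p" for n
    using word_value_snoc_eq_nat[OF digits, of "inf_prefix n w" n "b (Suc n)"] b[of n] b[of "Suc n"]
    by (simp_all add: snoc)
  have rec: "real (b (Suc n)) = r * real (b n) + real (w n) / real q" for n
    using b[of n] b[of "Suc n"] by (simp add: snoc word_value_snoc r_def add_divide_distrib)
  have powi: "r powi (k + 1 - int n) = r * r powi (k - int n)"
    "r powi (1 + k - int n) = r * r powi (k - int n)" for n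
    using r power_int_add[of r 1 "k - int n"] by (simp_all add: algebra_simps)
  have partial: "(\<Sum>i<n. 1 / real q * (real (w i) * r powi (k - int i)))
      = real (b n) * r powi (k + 1 - int n)" for n
  proof (induction n)
    case (Suc n)
    have "k + 1 - int (Suc n) = k - int n" by simp
    with Suc show ?case by (simp add: rec powi algebra_simps)
  qed (simp add: b0)
  have conv: "(\<lambda>n. real (b n) * r powi (k + 1 - int n)) \<longlonglongrightarrow> x"
    using sums unfolding sums_def partial .
  have vanish: "(\<lambda>n. r powi (k + 1 - int n)) \<longlonglongrightarrow> 0"
  proof -
    have "r powi (k + 1 - int n) = r powi (k + 1) * (1 / r) ^ n" for n
      using r by (simp add: power_int_diff power_divide)
    moreover have "(\<lambda>n. r powi (k + 1) * (1 / r) ^ n) \<longlonglongrightarrow> 0"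
      using r by (intro tendsto_mult_right_zero LIMSEQ_power_zero) simp
    ultimately show ?thesis by simp
  qed
  have conv': "(\<lambda>n. real (b n + p) * r powi (k + 1 - int n)) \<longlonglongrightarrow> x"
    using tendsto_add[OF conv tendsto_mult_right_zero[OF vanish, of "real p"]]
    by (simp add: algebra_simps)
  have lower: "real (b n) * r powi (k + 1 - int n) \<le> x" for n
  proof (rule incseq_le[OF _ conv], rule incseq_SucI)
    fix n
    have "0 \<le> real (w n) / real q * r powi (k - int n)"
      using r by simp
    then show "real (b n) * r powi (k + 1 - int n)
        \<le> real (b (Suc n)) * r powi (k + 1 - int (Suc n))"
      by (simp add: rec powi algebra_simps)
  qed
  have upper: "x \<le> real (b n + p) * r powi (k + 1 - int n)" for n
  proof (rule decseq_ge[OF _ conv'], rule decseq_SucI)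
    fix n
    have "real (w n) + real p * real q \<le> real p * real p"
    proof -
      have "w n + p * q \<le> p * Suc q" using digits[of n] by simp
      also have "\<dots> \<le> p * p" using q_less_p by (intro mult_le_mono) auto
      finally show ?thesis by (metis of_nat_add of_nat_le_iff of_nat_mult)
    qed
    then have "(real (w n) + real p * real q) / real q \<le> real p * real p / real q"
      by (intro divide_right_mono) auto
    then have "real (w n) / real q + real p \<le> real p * r"
      using q_pos by (simp add: r_def add_divide_distrib)
    then have "(r * real (b n) + real (w n) / real q + real p) * r powi (k - int n)
        \<le> (r * real (b n) + real p * r) * r powi (k - int n)"
      using r by (intro mult_right_mono) auto
    then show "real (b (Suc n) + p) * r powi (k + 1 - int (Suc n))
        \<le> real (b n + p) * r powi (k + 1 - int n)"
      by (simp add: rec powi algebra_simps)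
  qed
  \<comment> \<open>For \<open>l > k\<close> the truncation of \<open>nat\<close> makes this \<open>b 0 = 0\<close>, as it should be.\<close>
  define N where "N l = b (nat (k + 1 - l))" for l
  have below: "nat (k + 1 - l) = Suc (nat (k - l))" "k + 1 - (l + 1) = k - l" if "l \<le> k" for l
    using that by auto
  show ?thesis
  proof (rule that[of N])
    fix l :: int
    show "parent p q (N l) = N (l + 1)"
      by (cases "l \<le> k") (simp_all add: N_def below step b0, simp_all add: parent_def)
    show "d l = q * N l mod p"
      by (cases "l \<le> k") (simp_all add: N_def below b0 d digit_sequence_def step(2)[symmetric])
    show "real (N l) * (real p / real q) powi l \<le> x"
    proof (cases "l \<le> k + 1")
      case True
      then show ?thesis using lower[of "nat (k + 1 - l)"] by (simp add: N_def r_def)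
    next
      case False
      then show ?thesis using lower[of 0] by (simp add: N_def b0)
    qed
    show "x \<le> real (N l + p) * (real p / real q) powi l"
    proof (cases "l \<le> k + 1")
      case True
      then show ?thesis using upper[of "nat (k + 1 - l)"] by (simp add: N_def r_def)
    next
      case False
      have "x \<le> real p * r powi (k + 1)"
        using upper[of 0] by (simp add: b0)
      also have "\<dots> \<le> real p * r powi l"
        using False r by (intro mult_left_mono power_int_increasing) auto
      finally show ?thesis using False by (simp add: N_def b0 r_def)
    qed
  qed
qed

lemma branch_funpow:
  assumes "\<And>l::int. parent p q (N l) = N (l + 1)"
  shows "(parent p q ^^ s) (N (l - int s)) = N l"
proof (induction s arbitrary: l)
  case (Suc s)
  have "(parent p q ^^ Suc s) (N (l - int (Suc s)))
      = parent p q ((parent p q ^^ s) (N (l - 1 - int s)))"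
    by (simp add: algebra_simps)
  also have "\<dots> = N l"
    using Suc.IH[of "l - 1"] assms[of "l - 1"] by simp
  finally show ?case .
qed simp

lemma branch_neq_below:
  assumes "\<And>l::int. parent p q (M l) = M (l + 1)" "\<And>l::int. parent p q (N l) = N (l + 1)"
    and "M l \<noteq> N l" "l' \<le> l"
  shows "M l' \<noteq> N l'"
  using branch_funpow[of M "nat (l - l')" l, OF assms(1)]
    branch_funpow[of N "nat (l - l')" l, OF assms(2)] assms(3,4) by auto

text \<open>
  The subtree below a node between the two branches is squeezed between them. As their
  distance never exceeds \<open>p\<close>, it cannot be arbitrarily wide.
\<close>

lemma no_node_between_branches:
  fixes A C :: "int \<Rightarrow> nat"
  assumes wide: "\<And>n k. 1 \<le> n \<Longrightarrow> \<exists>s. k \<le> card (descendants p q n s)"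
    and A: "\<And>l. parent p q (A l) = A (l + 1)"
    and C: "\<And>l. parent p q (C l) = C (l + 1)"
    and close: "\<And>l. C l \<le> A l + p"
    and between: "A l < b" "b < C l"
  shows False
proof -
  obtain s where s: "Suc p \<le> card (descendants p q b s)"
    using wide[of b "Suc p"] between by auto
  have "descendants p q b s \<subseteq> {A (l - int s)<..<C (l - int s)}"
  proof
    fix m assume "m \<in> descendants p q b s"
    then have m: "(parent p q ^^ s) m = b" by (simp add: descendants_def)
    have "A (l - int s) < m"
      using m between branch_funpow[of A s l, OF A] mono_strict_invE[OF mono_parent_funpow] by metis
    moreover have "m < C (l - int s)"
      using m between branch_funpow[of C s l, OF C] mono_strict_invE[OF mono_parent_funpow] by metis
    ultimately show "m \<in> {A (l - int s)<..<C (l - int s)}" by simp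
  qed
  then have "card (descendants p q b s) \<le> card {A (l - int s)<..<C (l - int s)}"
    by (intro card_mono) auto
  also have "\<dots> \<le> p"
    using close[of "l - int s"] by simp
  finally show False using s by simp
qed

lemma expansions_le_2:
  assumes wide: "\<And>n k. 1 \<le> n \<Longrightarrow> \<exists>s. k \<le> card (descendants p q n s)"
  shows "finite (expansions p q x) \<and> card (expansions p q x) \<le> 2"
proof (rule ccontr)
  assume "\<not> ?thesis"
  then obtain T where "T \<subseteq> expansions p q x" "card T = 3"
    by (metis infinite_arbitrarily_large obtain_subset_with_card_n not_less_eq_eq
        numeral_2_eq_2 numeral_3_eq_3)
  then obtain d1 d2 d3 where d: "d1 \<in> expansions p q x" "d2 \<in> expansions p q x"
    "d3 \<in> expansions p q x" and distinct: "d1 \<noteq> d2" "d1 \<noteq> d3" "d2 \<noteq> d3"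
    by (auto simp: card_3_iff)
  let ?r = "real p / real q"
  have "\<exists>N. (\<forall>l. parent p q (N l) = N (l + 1)) \<and> (\<forall>l. d l = q * N l mod p)
      \<and> (\<forall>l. real (N l) * ?r powi l \<le> x) \<and> (\<forall>l. x \<le> real (N l + p) * ?r powi l)"
    if "d \<in> expansions p q x" for d
    using expansion_truncations[OF that] by metis
  then obtain N where
    branch: "\<And>d l. d \<in> expansions p q x \<Longrightarrow> parent p q (N d l) = N d (l + 1)" and
    digit: "\<And>d l. d \<in> expansions p q x \<Longrightarrow> d l = q * N d l mod p" and
    lower: "\<And>d l. d \<in> expansions p q x \<Longrightarrow> real (N d l) * ?r powi l \<le> x" and
    upper: "\<And>d l. d \<in> expansions p q x \<Longrightarrow> x \<le> real (N d l + p) * ?r powi l"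
    by metis
  have close: "N e l \<le> N d l + p" if "d \<in> expansions p q x" "e \<in> expansions p q x" for d e l
  proof -
    have "real (N e l) * ?r powi l \<le> real (N d l + p) * ?r powi l"
      using lower[OF that(2)] upper[OF that(1)] by (rule order_trans)
    moreover have "0 < ?r powi l"
      using q_less_p q_pos by simp
    ultimately have "real (N e l) \<le> real (N d l + p)"
      by (simp only: mult_le_cancel_right_pos)
    then show ?thesis by (simp only: of_nat_le_iff)
  qed
  have squeeze: False
    if "d \<in> expansions p q x" "e \<in> expansions p q x" "N d l < b" "b < N e l" for d e l b
  proof (rule no_node_between_branches[of "N d" "N e" l b])
    show "\<exists>s. k \<le> card (descendants p q n s)" if "1 \<le> n" for n k
      using that by (rule wide)
    show "parent p q (N d l) = N d (l + 1)" for l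
      using that(1) by (rule branch)
    show "parent p q (N e l) = N e (l + 1)" for l
      using that(2) by (rule branch)
    show "N e l \<le> N d l + p" for l
      using that(1,2) by (rule close)
    show "N d l < b" "b < N e l"
      by (fact that(3), fact that(4))
  qed
  have separate: "\<exists>l. \<forall>l'\<le>l. N d l' \<noteq> N e l'"
    if de: "d \<in> expansions p q x" "e \<in> expansions p q x" "d \<noteq> e" for d e
  proof -
    obtain l where "d l \<noteq> e l"
      using \<open>d \<noteq> e\<close> by blast
    then have "N d l \<noteq> N e l"
      using digit[OF de(1), of l] digit[OF de(2), of l] by auto
    then have "N d l' \<noteq> N e l'" if "l' \<le> l" for l'
      using that
      by (rule branch_neq_below[of "N d" "N e" l l', OF branch[OF de(1)] branch[OF de(2)]])
    then show ?thesis by blast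
  qed
  obtain l12 where l12: "\<And>l. l \<le> l12 \<Longrightarrow> N d1 l \<noteq> N d2 l"
    using separate[OF d(1,2) distinct(1)] by blast
  obtain l13 where l13: "\<And>l. l \<le> l13 \<Longrightarrow> N d1 l \<noteq> N d3 l"
    using separate[OF d(1,3) distinct(2)] by blast
  obtain l23 where l23: "\<And>l. l \<le> l23 \<Longrightarrow> N d2 l \<noteq> N d3 l"
    using separate[OF d(2,3) distinct(3)] by blast
  define l where "l = min l12 (min l13 l23)"
  have "N d1 l \<noteq> N d2 l" "N d1 l \<noteq> N d3 l" "N d2 l \<noteq> N d3 l"
    using l12[of l] l13[of l] l23[of l] by (simp_all add: l_def)
  moreover have "\<not> (N d1 l < N d2 l \<and> N d2 l < N d3 l)" "\<not> (N d3 l < N d2 l \<and> N d2 l < N d1 l)"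
    "\<not> (N d1 l < N d3 l \<and> N d3 l < N d2 l)" "\<not> (N d2 l < N d3 l \<and> N d3 l < N d1 l)"
    "\<not> (N d2 l < N d1 l \<and> N d1 l < N d3 l)" "\<not> (N d3 l < N d1 l \<and> N d1 l < N d2 l)"
    using squeeze d by blast+
  ultimately show False by linarith
qed

end

section \<open>At most two expansions\<close>

theorem proposition3p10:
  assumes "\<forall>p q :: nat. coprime p q \<and> q < p \<and> 1 \<le> q \<longrightarrow>
      (\<forall>u \<in> rep_lang p q. normal_over {p - q..p - 1} (wmax p q u)) \<and>
      (\<forall>u \<in> rep_lang p q. u \<noteq> [] \<longrightarrow> normal_over {0..q - 1} (wmin p q u))"
  shows "\<forall>p q :: nat. coprime p q \<and> q < p \<and> 1 \<le> q \<longrightarrow>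
      (\<forall>x :: real. 0 < x \<longrightarrow> finite (expansions p q x) \<and> card (expansions p q x) \<le> 2)"
proof (intro allI impI)
  fix p q :: nat and x :: real
  assume pq: "coprime p q \<and> q < p \<and> 1 \<le> q"
  then interpret rational_base p q
    by unfold_locales auto
  have "\<exists>t. \<exists>x\<in>descendants p q n t. \<exists>y\<in>descendants p q n t. x \<noteq> y" if "1 \<le> n" for n
    using assms pq that by (intro normality_imp_branching) blast+
  then show "finite (expansions p q x) \<and> card (expansions p q x) \<le> 2"
    by (intro expansions_le_2 many_descendants)
qed

end
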